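(* Let $X$ be a first countable Hausdorff space and let $\mathcal{L}\subset X\times X$ be a countable Borel equivalence relation. Let $\mathcal{R}\subset\mathcal{L}$ be an equivalence subrelation of $\mathcal{L}$ (itself a countable Borel equivalence relation), and let $\mu$ be a Borel probability measure on $X$ that is $\mathcal{R}$-quasi-invariant (so $\mathcal{R}$ is $\mu$-nonsingular) and $\mathcal{R}$-ergodic. Suppose that there exists a point $x$ in the support of $\mu$ such that $\mathcal{L}[x]=\{x\}$. If $Z$ is a closed $\mathcal{L}$-minimal subset of $X$, then either $Z=\{x\}$ or $\mu(Z)=0$.
   Context: $X$ carries the Borel $\sigma$-algebra of its topology. A countable Borel equivalence relation on $X$ is an equivalence relation that is a Borel subset of $X\times X$ and all of whose classes are countable. For an equivalence relation $\mathcal{R}$ on $X$, $\mathcal{R}[x]=\{y\in X : (x,y)\in\mathcal{R}\}$ is the class of $x$, and $\mathcal{R}[B]=\bigcup_{x\in B}\mathcal{R}[x]$ for $B\subset X$; likewise for $\mathcal{L}$. Quasi-invariance: $\mu$ is $\mathcal{R}$-quasi-invariant (equivalently, $\mathcal{R}$ is $\mu$-nonsingular) if for every partial transformation $\varphi:A\to B$ of $\mathcal{R}$ (a measurable bijection between Borel sets whose graph is contained in $\mathcal{R}$) and every Borel $A'\subset A$, $\mu(A')=0$ if and only if $\mu(\varphi(A'))=0$. Ergodicity: $\mu$ is $\mathcal{R}$-ergodic if for every Borel set $B\subset X$ the saturation $\mathcal{R}[B]$ is $\mu$-measurable and $\mu(\mathcal{R}[B])=0$ or $\mu(\mathcal{R}[B])=1$.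 Support: a point $x$ belongs to the support of $\mu$ if every open neighbourhood of $x$ has positive $\mu$-measure. Minimality: a closed subset $Z\subset X$ is $\mathcal{L}$-minimal if for every $z\in Z$ the class $\mathcal{L}[z]$ is contained in $Z$ and dense in $Z$. *)

theory Defs
  imports "HOL-Probability.Probability"
begin

text \<open>
  The space \<open>X\<close> is the universe of a type. Equivalence relations are sets of pairs, so the class
  of \<open>x\<close> is \<open>R `` {x}\<close> and the saturation of \<open>B\<close> is \<open>R `` B\<close>. Outside second countable spaces
  the Borel sets of the product topology, used here, may be more than the product sigma-algebra.
\<close>

definition countable_borel_equiv :: "('a::topological_space \<times> 'a) set \<Rightarrow> bool" where
  "countable_borel_equiv R \<longleftrightarrow>
     equiv UNIV R \<and> R \<in> sets borel \<and> (\<forall>x. countable (R `` {x}))"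

definition borel_prob :: "'a::topological_space measure \<Rightarrow> bool" where
  "borel_prob \<mu> \<longleftrightarrow> prob_space \<mu> \<and> sets \<mu> = sets borel"

text \<open>The values of \<open>\<phi>\<close> outside \<open>A\<close> are irrelevant. Measurability of the inverse is not demanded.\<close>

definition partial_transformation ::
    "('a::topological_space \<times> 'a) set \<Rightarrow> 'a set \<Rightarrow> 'a set \<Rightarrow> ('a \<Rightarrow> 'a) \<Rightarrow> bool" where
  "partial_transformation R A B \<phi> \<longleftrightarrow>
     A \<in> sets borel \<and> B \<in> sets borel \<and> bij_betw \<phi> A B \<and>
     \<phi> \<in> restrict_space borel A \<rightarrow>\<^sub>M restrict_space borel B \<and>
     (\<forall>a\<in>A. (a, \<phi> a) \<in> R)"

text \<open>
  In a general topological space \<open>\<phi> ` A'\<close> need not be Borel, and \<open>emeasure\<close> is \<open>0\<close> by convention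
  on non-measurable sets; so ``\<open>\<phi> ` A'\<close> has measure zero'' is read as being a null set of the completion
  of \<open>\<mu>\<close>, which for Borel \<open>\<phi> ` A'\<close> is the same as \<open>emeasure \<mu> (\<phi> ` A') = 0\<close>.
\<close>

definition quasi_invariant ::
    "('a::topological_space \<times> 'a) set \<Rightarrow> 'a measure \<Rightarrow> bool" where
  "quasi_invariant R \<mu> \<longleftrightarrow>
     (\<forall>A B \<phi>. partial_transformation R A B \<phi> \<longrightarrow>
        (\<forall>A'\<in>sets borel. A' \<subseteq> A \<longrightarrow>
           (emeasure \<mu> A' = 0 \<longleftrightarrow> \<phi> ` A' \<in> null_sets (completion \<mu>))))"

definition ergodic_measure ::
    "('a::topological_space \<times> 'a) set \<Rightarrow> 'a measure \<Rightarrow> bool" where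
  "ergodic_measure R \<mu> \<longleftrightarrow>
     (\<forall>B\<in>sets borel. R `` B \<in> sets (completion \<mu>) \<and>
        (emeasure (completion \<mu>) (R `` B) = 0 \<or> emeasure (completion \<mu>) (R `` B) = 1))"

definition measure_support :: "'a::topological_space measure \<Rightarrow> 'a set" where
  "measure_support \<mu> = {x. \<forall>U. open U \<and> x \<in> U \<longrightarrow> emeasure \<mu> U > 0}"

text \<open>For \<open>L `` {z} \<subseteq> Z\<close>, the inclusion \<open>Z \<subseteq> closure (L `` {z})\<close> is density in the subspace \<open>Z\<close>.
  The empty set is minimal.\<close>

definition minimal_set :: "('a::topological_space \<times> 'a) set \<Rightarrow> 'a set \<Rightarrow> bool" where
  "minimal_set L Z \<longleftrightarrow>
     closed Z \<and> (\<forall>z\<in>Z. L `` {z} \<subseteq> Z \<and> Z \<subseteq> closure (L `` {z}))"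

end

theory Submission
  imports Defs
begin

text \<open>
  A minimal set \<open>Z\<close> is \<open>L\<close>-invariant, hence invariant under the subrelation \<open>R\<close>, so ergodicity
  gives it measure \<open>0\<close> or \<open>1\<close>. If \<open>Z\<close> contains \<open>x\<close>, it is the closure of the one-point class
  of \<open>x\<close>, which is \<open>{x}\<close>. Otherwise the complement of \<open>Z\<close> is an open neighbourhood of the support
  point \<open>x\<close>, which has positive measure; this rules out measure \<open>1\<close>.
\<close>

lemma ergodic_closed_invariant:
  assumes "ergodic_measure R \<mu>" "sets \<mu> = sets borel" "closed Z" "R `` Z = Z"
  shows "emeasure \<mu> Z = 0 \<or> emeasure \<mu> Z = 1"
proof -
  have "Z \<in> sets borel"
    using \<open>closed Z\<close> by (rule borel_closed)
  with assms have "emeasure (completion \<mu>) Z = 0 \<or> emeasure (completion \<mu>) Z = 1"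
    unfolding ergodic_measure_def by metis
  moreover have "emeasure (completion \<mu>) Z = emeasure \<mu> Z"
    using \<open>Z \<in> sets borel\<close> assms(2) by (simp add: emeasure_completion)
  ultimately show ?thesis by simp
qed

lemma full_measure_closed_contains_support:
  assumes "borel_prob \<mu>" "closed Z" "emeasure \<mu> Z = 1"
  shows "measure_support \<mu> \<subseteq> Z"
proof (rule subsetI, rule ccontr)
  fix x assume "x \<in> measure_support \<mu>" "x \<notin> Z"
  then have pos: "emeasure \<mu> (- Z) > 0"
    using \<open>closed Z\<close> by (auto simp: measure_support_def open_Compl)
  interpret prob_space \<mu>
    using assms(1) by (simp add: borel_prob_def)
  have sets: "sets \<mu> = sets borel"
    using assms(1) by (simp add: borel_prob_def)
  then have "space \<mu> = UNIV"
    using sets_eq_imp_space_eq[of \<mu> borel] by simp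
  moreover have "Z \<in> sets \<mu>"
    using \<open>closed Z\<close> sets by simp
  ultimately have "emeasure \<mu> (- Z) = 0"
    using emeasure_compl[of Z \<mu>] assms(3) emeasure_space_1 by (simp add: Compl_eq_Diff_UNIV)
  with pos show False by simp
qed

theorem lemma2p1:
  fixes L R :: "('a::{first_countable_topology, t2_space} \<times> 'a) set"
    and \<mu> :: "'a measure" and x :: 'a and Z :: "'a set"
  assumes "countable_borel_equiv L"
    and "countable_borel_equiv R"
    and "R \<subseteq> L"
    and "borel_prob \<mu>"
    and "quasi_invariant R \<mu>"
    and "ergodic_measure R \<mu>"
    and "x \<in> measure_support \<mu>"
    and "L `` {x} = {x}"
    and "minimal_set L Z"
  shows "Z = {x} \<or> emeasure \<mu> Z = 0"
proof (cases "x \<in> Z")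
  case True
  then have "Z \<subseteq> closure {x}"
    using assms(8,9) unfolding minimal_set_def by metis
  with True show ?thesis by auto
next
  case False
  have "closed Z" and invariant: "\<And>z. z \<in> Z \<Longrightarrow> L `` {z} \<subseteq> Z"
    using assms(9) by (auto simp: minimal_set_def)
  have "refl R"
    using assms(2) by (simp add: countable_borel_equiv_def equiv_def)
  then have "R `` Z = Z"
    using invariant \<open>R \<subseteq> L\<close> by (fastforce simp: refl_on_def)
  then have "emeasure \<mu> Z = 0 \<or> emeasure \<mu> Z = 1"
    using ergodic_closed_invariant[OF assms(6) _ \<open>closed Z\<close>] assms(4) by (simp add: borel_prob_def)
  moreover have "emeasure \<mu> Z \<noteq> 1"
    using full_measure_closed_contains_support[OF assms(4) \<open>closed Z\<close>] assms(7) False by blast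
  ultimately show ?thesis by simp
qed

end
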